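(* Let $A\in\mathbb{R}^{N\times N}$ be an irreducible SDD matrix that has positive off-diagonal entries and is not a bipartite SDD matrix, and write $A=A_d+A_n+A_p$, where $A_d$, $A_n$, $A_p$ contain respectively the diagonal, the negative off-diagonal, and the positive off-diagonal entries of $A$. Let $b\in\mathbb{R}^N$ be nonzero, let $\epsilon>0$, and let $$\tilde A=\begin{pmatrix}A_d+A_n & -A_p\\ -A_p & A_d+A_n\end{pmatrix}\in\mathbb{R}^{2N\times 2N},\qquad \tilde b=\begin{pmatrix} b\\ -b\end{pmatrix}\in\mathbb{R}^{2N}.$$ Suppose $y=\begin{pmatrix} y_1\\ -y_2\end{pmatrix}$ with $y_1,y_2\in\mathbb{R}^N$ satisfies $\|\tilde b-\tilde A y\|/\|\tilde b\|<\epsilon$. Then the vector $x=\frac{y_1+y_2}{2}$ satisfies $\|b-Ax\|/\|b\|<\epsilon$.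
   Context: $\|\cdot\|$ is the Euclidean norm. A matrix $A=(a_{ij})\in\mathbb{R}^{N\times N}$ is SDD (symmetric diagonally dominant) if $A=A^\top$ and $a_{ii}\ge\sum_{j\ne i}|a_{ij}|$ for all $i$ (in particular the diagonal is nonnegative). $A$ is irreducible if there is no permutation matrix $P$ such that $P^\top AP$ is block triangular. An irreducible SDD matrix $A$ is a bipartite SDD matrix if there exists a diagonal matrix $D$ with diagonal entries in $\{1,-1\}$ such that $DAD$ has only non-positive off-diagonal entries. *)

theory Defs
  imports
    "Jordan_Normal_Form.Matrix"
    "HOL-Combinatorics.Permutations"
    "HOL-Analysis.L2_Norm"
begin

definition euclidean_norm :: "real vec \<Rightarrow> real" where
  "euclidean_norm v = L2_set (\<lambda>i. v $ i) {..<dim_vec v}"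

definition SDD :: "real mat \<Rightarrow> bool" where
  "SDD A \<longleftrightarrow> square_mat A \<and> transpose_mat A = A \<and>
     (\<forall>i < dim_row A. A $$ (i,i) \<ge> (\<Sum>j \<in> {..<dim_row A} - {i}. \<bar>A $$ (i,j)\<bar>))"

definition permutation_mat :: "nat \<Rightarrow> real mat \<Rightarrow> bool" where
  "permutation_mat n P \<longleftrightarrow>
     (\<exists>p. p permutes {..<n} \<and> P = mat n n (\<lambda>(i,j). if i = p j then 1 else 0))"

text \<open>The diagonal blocks are square and nonempty. Two of them suffice: a block triangular matrix
  with more diagonal blocks becomes one with two after merging blocks. With the strict bounds on
  the block sizes, every \<open>1 \<times> 1\<close> matrix is irreducible, including the zero matrix.\<close>

definition block_triangular :: "real mat \<Rightarrow> bool" where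
  "block_triangular M \<longleftrightarrow>
     (\<exists>n1 n2 B C D. 0 < n1 \<and> 0 < n2 \<and> B \<in> carrier_mat n1 n1 \<and> D \<in> carrier_mat n2 n2 \<and>
        (C \<in> carrier_mat n1 n2 \<and> M = four_block_mat B C (0\<^sub>m n2 n1) D \<or>
         C \<in> carrier_mat n2 n1 \<and> M = four_block_mat B (0\<^sub>m n1 n2) C D))"

definition irreducible_mat :: "real mat \<Rightarrow> bool" where
  "irreducible_mat A \<longleftrightarrow>
     \<not> (\<exists>P. permutation_mat (dim_row A) P \<and> block_triangular (transpose_mat P * A * P))"

definition bipartite_SDD :: "real mat \<Rightarrow> bool" where
  "bipartite_SDD A \<longleftrightarrow> irreducible_mat A \<and> SDD A \<and>
     (\<exists>D \<in> carrier_mat (dim_row A) (dim_row A).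
        diagonal_mat D \<and> (\<forall>i < dim_row A. D $$ (i,i) \<in> {1, -1}) \<and>
        (\<forall>i < dim_row A. \<forall>j < dim_row A. i \<noteq> j \<longrightarrow> (D * A * D) $$ (i,j) \<le> 0))"

definition diag_part :: "real mat \<Rightarrow> real mat" where
  "diag_part A = mat (dim_row A) (dim_col A) (\<lambda>(i,j). if i = j then A $$ (i,j) else 0)"

definition neg_offdiag_part :: "real mat \<Rightarrow> real mat" where
  "neg_offdiag_part A = mat (dim_row A) (dim_col A)
     (\<lambda>(i,j). if i \<noteq> j \<and> A $$ (i,j) < 0 then A $$ (i,j) else 0)"

definition pos_offdiag_part :: "real mat \<Rightarrow> real mat" where
  "pos_offdiag_part A = mat (dim_row A) (dim_col A)
     (\<lambda>(i,j). if i \<noteq> j \<and> A $$ (i,j) > 0 then A $$ (i,j) else 0)"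

lemma parts_decomposition:
  "A = diag_part A + neg_offdiag_part A + pos_offdiag_part A"
  by (rule eq_matI) (auto simp: diag_part_def neg_offdiag_part_def pos_offdiag_part_def)

definition tilde_mat :: "real mat \<Rightarrow> real mat" where
  "tilde_mat A = four_block_mat
     (diag_part A + neg_offdiag_part A) (- pos_offdiag_part A)
     (- pos_offdiag_part A) (diag_part A + neg_offdiag_part A)"

definition tilde_vec :: "real vec \<Rightarrow> real vec" where
  "tilde_vec b = b @\<^sub>v (- b)"

end

theory Submission
  imports Defs
begin

text \<open>
  Write \<open>M = A\<^sub>d + A\<^sub>n\<close> and \<open>P = A\<^sub>p\<close>, so \<open>A = M + P\<close>. The doubled matrix has the block form
  \<open>(M, -P; -P, M)\<close>, which acts as \<open>M + P = A\<close> on pairs \<open>(z, -z)\<close>. Accordingly, the map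
  \<open>(u, w) \<mapsto> u - w\<close> turns multiplication of \<open>(y\<^sub>1, -y\<^sub>2)\<close> by the doubled matrix into multiplication
  of \<open>y\<^sub>1 + y\<^sub>2\<close> by \<open>A\<close>, and it sends \<open>(b, -b)\<close> to \<open>2 b\<close>. It therefore sends the residual of the
  doubled system to \<open>2 (b - A x)\<close>. This map enlarges the Euclidean norm by a factor of at most
  \<open>\<surd>2\<close>, whereas the norm of \<open>(b, -b)\<close> is exactly \<open>\<surd>2\<close> times that of \<open>b\<close>; the relative residual
  of \<open>x\<close> is thus at most that of \<open>y\<close>.
\<close>

lemma euclidean_norm_nonneg: "0 \<le> euclidean_norm v"
  by (simp add: euclidean_norm_def)

lemma euclidean_norm_power2: "(euclidean_norm v)\<^sup>2 = (\<Sum>i<dim_vec v. (v $ i)\<^sup>2)"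
  by (simp add: euclidean_norm_def L2_set_def sum_nonneg)

lemma euclidean_norm_uminus: "euclidean_norm (- v) = euclidean_norm v"
  by (simp add: euclidean_norm_def L2_set_def)

lemma euclidean_norm_smult: "euclidean_norm (c \<cdot>\<^sub>v v) = \<bar>c\<bar> * euclidean_norm v"
proof (rule power2_eq_imp_eq)
  show "(euclidean_norm (c \<cdot>\<^sub>v v))\<^sup>2 = (\<bar>c\<bar> * euclidean_norm v)\<^sup>2"
    by (simp add: euclidean_norm_power2 power_mult_distrib sum_distrib_left)
qed (simp_all add: euclidean_norm_nonneg)

lemma euclidean_norm_append_power2:
  "(euclidean_norm (u @\<^sub>v w))\<^sup>2 = (euclidean_norm u)\<^sup>2 + (euclidean_norm w)\<^sup>2"
proof -
  have "(\<Sum>i<m + n. ((u @\<^sub>v w) $ i)\<^sup>2) = (\<Sum>i<m. (u $ i)\<^sup>2) + (\<Sum>i<n. (w $ i)\<^sup>2)"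
    if "m = dim_vec u" "n \<le> dim_vec w" for m n
    using that(2)
  proof (induction n)
    case 0
    then show ?case using that(1) by simp
  next
    case (Suc n)
    then show ?case using that(1) by simp
  qed
  then show ?thesis
    by (simp add: euclidean_norm_power2)
qed

lemma euclidean_norm_tilde_vec: "euclidean_norm (tilde_vec b) = sqrt 2 * euclidean_norm b"
proof (rule power2_eq_imp_eq)
  show "(euclidean_norm (tilde_vec b))\<^sup>2 = (sqrt 2 * euclidean_norm b)\<^sup>2"
    by (simp add: tilde_vec_def euclidean_norm_append_power2 euclidean_norm_uminus
        power_mult_distrib)
qed (simp_all add: euclidean_norm_nonneg)

text \<open>By the parallelogram law, \<open>\<parallel>u - w\<parallel>\<^sup>2 + \<parallel>u + w\<parallel>\<^sup>2 = 2 (\<parallel>u\<parallel>\<^sup>2 + \<parallel>w\<parallel>\<^sup>2)\<close>.\<close>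

lemma euclidean_norm_diff_le_append:
  assumes "u \<in> carrier_vec n" "w \<in> carrier_vec n"
  shows "euclidean_norm (u - w) \<le> sqrt 2 * euclidean_norm (u @\<^sub>v w)"
proof (rule power2_le_imp_le)
  have "(a - c)\<^sup>2 \<le> 2 * (a\<^sup>2 + c\<^sup>2)" for a c :: real
    using zero_le_power2[of "a + c"] by (simp add: power2_sum power2_diff)
  then have "(\<Sum>i<n. (u $ i - w $ i)\<^sup>2) \<le> (\<Sum>i<n. 2 * ((u $ i)\<^sup>2 + (w $ i)\<^sup>2))"
    by (intro sum_mono)
  then have "(euclidean_norm (u - w))\<^sup>2 \<le> 2 * ((euclidean_norm u)\<^sup>2 + (euclidean_norm w)\<^sup>2)"
    using assms by (simp add: euclidean_norm_power2 sum.distrib flip: sum_distrib_left)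
  then show "(euclidean_norm (u - w))\<^sup>2 \<le> (sqrt 2 * euclidean_norm (u @\<^sub>v w))\<^sup>2"
    by (simp add: power_mult_distrib euclidean_norm_append_power2)
qed (simp add: euclidean_norm_nonneg)

text \<open>The doubled system for the unknown \<open>(y\<^sub>1, -y\<^sub>2)\<close> consists of the two equations
  \<open>M y\<^sub>1 + P y\<^sub>2 = b\<close> and \<open>P y\<^sub>1 + M y\<^sub>2 = b\<close>, the second one negated; their sum is
  \<open>A (y\<^sub>1 + y\<^sub>2) = 2 b\<close>.\<close>

lemma tilde_residual_halves:
  assumes A: "A \<in> carrier_mat N N" and b: "b \<in> carrier_vec N"
    and y1: "y1 \<in> carrier_vec N" and y2: "y2 \<in> carrier_vec N"
  obtains u w where "u \<in> carrier_vec N" "w \<in> carrier_vec N"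
    and "tilde_vec b - tilde_mat A *\<^sub>v (y1 @\<^sub>v (- y2)) = u @\<^sub>v w"
    and "b - A *\<^sub>v ((1 / 2) \<cdot>\<^sub>v (y1 + y2)) = (1 / 2) \<cdot>\<^sub>v (u - w)"
proof
  define M where "M = diag_part A + neg_offdiag_part A"
  define P where "P = pos_offdiag_part A"
  have M: "M \<in> carrier_mat N N" and P: "P \<in> carrier_mat N N"
    using A by (simp_all add: M_def P_def diag_part_def neg_offdiag_part_def pos_offdiag_part_def)
  have A_eq: "A = M + P"
    unfolding M_def P_def by (rule parts_decomposition)
  let ?u = "b - (M *\<^sub>v y1 + P *\<^sub>v y2)"
  let ?w = "- (b - (P *\<^sub>v y1 + M *\<^sub>v y2))"
  show "?u \<in> carrier_vec N" "?w \<in> carrier_vec N"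
    using M P b y1 y2 by auto
  have "tilde_mat A *\<^sub>v (y1 @\<^sub>v (- y2))
      = (M *\<^sub>v y1 + (- P) *\<^sub>v (- y2)) @\<^sub>v ((- P) *\<^sub>v y1 + M *\<^sub>v (- y2))"
    unfolding tilde_mat_def M_def[symmetric] P_def[symmetric]
    using M P y1 y2 by (intro four_block_mat_mult_vec) auto
  then show "tilde_vec b - tilde_mat A *\<^sub>v (y1 @\<^sub>v (- y2)) = ?u @\<^sub>v ?w"
    using M P b y1 y2 by (intro eq_vecI) (auto simp: tilde_vec_def)
  have "A *\<^sub>v (y1 + y2) = M *\<^sub>v y1 + P *\<^sub>v y1 + (M *\<^sub>v y2 + P *\<^sub>v y2)"
    using M P y1 y2
    by (simp add: A_eq add_mult_distrib_mat_vec[where nr = N and nc = N]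
        mult_add_distrib_mat_vec[where nr = N and nc = N])
  moreover have "A *\<^sub>v ((1 / 2) \<cdot>\<^sub>v (y1 + y2)) = (1 / 2) \<cdot>\<^sub>v (A *\<^sub>v (y1 + y2))"
    using A y1 y2 by (intro mult_mat_vec) auto
  ultimately show "b - A *\<^sub>v ((1 / 2) \<cdot>\<^sub>v (y1 + y2)) = (1 / 2) \<cdot>\<^sub>v (?u - ?w)"
    using M P b y1 y2 by (intro eq_vecI) (auto simp: field_simps)
qed

theorem theorem3p8:
  fixes N :: nat and A :: "real mat" and b y y1 y2 x :: "real vec" and \<epsilon> :: real
  assumes "A \<in> carrier_mat N N"
    and "irreducible_mat A"
    and "SDD A"
    and "\<exists>i<N. \<exists>j<N. i \<noteq> j \<and> A $$ (i,j) > 0"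
    and "\<not> bipartite_SDD A"
    and "b \<in> carrier_vec N"
    and "b \<noteq> 0\<^sub>v N"
    and "\<epsilon> > 0"
    and "y1 \<in> carrier_vec N"
    and "y2 \<in> carrier_vec N"
    and "y = y1 @\<^sub>v (- y2)"
    and "euclidean_norm (tilde_vec b - tilde_mat A *\<^sub>v y) / euclidean_norm (tilde_vec b) < \<epsilon>"
    and "x = (1 / 2) \<cdot>\<^sub>v (y1 + y2)"
  shows "euclidean_norm (b - A *\<^sub>v x) / euclidean_norm b < \<epsilon>"
proof -
  obtain u w where uw: "u \<in> carrier_vec N" "w \<in> carrier_vec N"
    and tilde_res: "tilde_vec b - tilde_mat A *\<^sub>v y = u @\<^sub>v w"
    and res: "b - A *\<^sub>v x = (1 / 2) \<cdot>\<^sub>v (u - w)"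
    using tilde_residual_halves[OF assms(1,6,9,10)] assms(11,13) by metis
  have "euclidean_norm (b - A *\<^sub>v x) \<le> sqrt 2 * euclidean_norm (u @\<^sub>v w) / 2"
    using euclidean_norm_diff_le_append[OF uw] by (simp add: res euclidean_norm_smult)
  also have "\<dots> = euclidean_norm (u @\<^sub>v w) / sqrt 2"
    by (simp add: field_simps)
  finally have "euclidean_norm (b - A *\<^sub>v x) / euclidean_norm b
      \<le> euclidean_norm (u @\<^sub>v w) / sqrt 2 / euclidean_norm b"
    by (intro divide_right_mono euclidean_norm_nonneg)
  also have "\<dots> = euclidean_norm (tilde_vec b - tilde_mat A *\<^sub>v y) / euclidean_norm (tilde_vec b)"
    by (simp add: tilde_res euclidean_norm_tilde_vec)
  finally show ?thesis
    using assms(12) by simp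
qed

end
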